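(* Let $m,r\ge 1$ be integers, let $X\in\mathbb{R}^{m\times m}$ be symmetric, let $a_1,b_1,a_2>0$ and $\varepsilon_1,\varepsilon_2>0$, and let $h_1,h_2:\mathbb{R}^{m\times r}\times\mathbb{R}^{r\times r}\to\overline{\mathbb{R}}$ be the strongly convex kernel functions $$h_1(U,V):=\tfrac{a_1}{4}\|V\|_F^2\|U\|_F^4+\tfrac{b_1}{2}\left(\|X\|_F\|V\|_F+\varepsilon_1\right)\|U\|_F^2,$$ $$h_2(U,V):=\tfrac{a_2}{2}\left(\|U\|_F^4+\varepsilon_2\right)\|V\|_F^2 .$$ Then the function $f:\mathbb{R}^{m\times r}\times\mathbb{R}^{r\times r}\to\overline{\mathbb{R}}$ given by $f(U,V):=\tfrac12\|X-UVU^T\|_F^2$ is $(L_1,L_2)$-smooth relative to $(h_1,h_2)$ with $$L_1\ge\max\left\{\tfrac{6}{a_1},\tfrac{2}{b_1}\right\}\quad\text{and}\quad L_2\ge\tfrac{1}{a_2}.$$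
   Context: $\overline{\mathbb{R}}=\mathbb{R}\cup\{\infty\}$ and $\|\cdot\|_F$ is the Frobenius norm. There are two blocks of variables: $U$ is the first block and $V$ the second. Let $h$ be a proper lower semicontinuous function of $(U,V)$ with values in $\overline{\mathbb{R}}$, with $\mathrm{int}\,\mathrm{dom}\,h\neq\emptyset$ and $h\in C^1(\mathrm{int}\,\mathrm{dom}\,h)$. For $i\in\{1,2\}$, $h$ is called $i$-th block (strongly) convex if, for every point of $\mathrm{dom}\,h$, the function obtained from $h$ by letting only the $i$-th block vary, the other block being fixed at its value at that point, is (strongly) convex. It is called an $i$-th block kernel function if it is $i$-th block convex and each of these functions $\phi$ of the $i$-th block is 1-coercive, i.e. $\phi(Z)/\|Z\|\to\infty$ as $\|Z\|\to\infty$. That $h_1$ and $h_2$ are strongly convex kernel functions means that $h_i$ is an $i$-th block kernel function and $i$-th block strongly convex, $i=1,2$. Block relative smoothness: let $h_i$ be $i$-th block kernel functions ($i=1,2$), let $f$ be proper and lower semicontinuous, and let $L_1,L_2>0$. The function $f$ is called $(L_1,L_2)$-smooth relative to $(h_1,h_2)$ if, for each $i$, the function $L_ih_i-f$ is convex in the $i$-th block, with the other block fixed, over points of $\mathrm{int}\,\mathrm{dom}\,h_i$; that is, $U\mapsto L_1h_1(U,V)-f(U,V)$ is convex for each fixed $V$, and $V\mapsto L_2h_2(U,V)-f(U,V)$ is convex for each fixed $U$.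
   Formalization: For X≠0, h_1 is not differentiable at V=0, U≠0, so it is not C^1 on int dom h_1; an i-th block kernel is here only required to have a jointly continuous i-th partial derivative. Joint C^1 is proved for h_2, and for h_1 where V≠0 or X=0. *)

theory Defs
  imports "HOL-Analysis.Analysis"
begin

text \<open>
  Matrices are vectors of rows, so the library norm on \<^typ>\<open>real^'n^'m\<close> is the Frobenius norm.
\<close>

lemma norm_matrix_eq_Frobenius:
  fixes A :: "real^'n^'m"
  shows "norm A = sqrt (\<Sum>i\<in>UNIV. \<Sum>j\<in>UNIV. (A $ i $ j)\<^sup>2)"
  by (simp add: norm_vec_def L2_set_def sum_nonneg)

section \<open>Extended-real-valued functions\<close>

definition edom :: "('a \<Rightarrow> ereal) \<Rightarrow> 'a set" where
  "edom h = {x. h x < \<infinity>}"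

definition proper_fun :: "('a \<Rightarrow> ereal) \<Rightarrow> bool" where
  "proper_fun h \<longleftrightarrow> (\<forall>x. h x \<noteq> -\<infinity>) \<and> edom h \<noteq> {}"

definition lsc_fun :: "('a::topological_space \<Rightarrow> ereal) \<Rightarrow> bool" where
  "lsc_fun h \<longleftrightarrow> (\<forall>x. h x \<le> Liminf (at x) h)"

text \<open>
  Convexity is only used for functions that never take both values \<open>\<infinity>\<close> and \<open>-\<infinity>\<close>, so the
  right-hand side is never an undefined sum; in \<^typ>\<open>ereal\<close>, \<open>0 * \<infinity> = 0\<close>.
\<close>

definition econvex_on :: "'a::real_vector set \<Rightarrow> ('a \<Rightarrow> ereal) \<Rightarrow> bool" where
  "econvex_on S \<phi> \<longleftrightarrow> convex S \<and>
     (\<forall>x\<in>S. \<forall>y\<in>S. \<forall>u\<ge>0. \<forall>v\<ge>0. u + v = 1 \<longrightarrow>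
        \<phi> (u *\<^sub>R x + v *\<^sub>R y) \<le> ereal u * \<phi> x + ereal v * \<phi> y)"

definition strongly_econvex_on :: "'a::real_normed_vector set \<Rightarrow> ('a \<Rightarrow> ereal) \<Rightarrow> bool" where
  "strongly_econvex_on S \<phi> \<longleftrightarrow> convex S \<and> (\<exists>\<mu>>0.
     \<forall>x\<in>S. \<forall>y\<in>S. \<forall>u\<ge>0. \<forall>v\<ge>0. u + v = 1 \<longrightarrow>
        \<phi> (u *\<^sub>R x + v *\<^sub>R y) + ereal (\<mu> / 2 * u * v * (norm (x - y))\<^sup>2)
          \<le> ereal u * \<phi> x + ereal v * \<phi> y)"

definition one_coercive :: "('a::real_normed_vector \<Rightarrow> ereal) \<Rightarrow> bool" where
  "one_coercive \<phi> \<longleftrightarrow> ((\<lambda>z. \<phi> z / ereal (norm z)) \<longlongrightarrow> \<infinity>) at_infinity"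

definition C1_on :: "'a::real_normed_vector set \<Rightarrow> ('a \<Rightarrow> ereal) \<Rightarrow> bool" where
  "C1_on S h \<longleftrightarrow> (\<exists>D :: 'a \<Rightarrow> 'a \<Rightarrow>\<^sub>L real. continuous_on S D \<and>
     (\<forall>x\<in>S. ((\<lambda>y. real_of_ereal (h y)) has_derivative blinfun_apply (D x)) (at x)))"

section \<open>Functions of two blocks\<close>

definition on_first_block ::
    "(('a \<Rightarrow> ereal) \<Rightarrow> bool) \<Rightarrow> ('a \<times> 'b \<Rightarrow> ereal) \<Rightarrow> bool" where
  "on_first_block P h \<longleftrightarrow> (\<forall>(U, V) \<in> edom h. P (\<lambda>U'. h (U', V)))"

definition on_second_block ::
    "(('b \<Rightarrow> ereal) \<Rightarrow> bool) \<Rightarrow> ('a \<times> 'b \<Rightarrow> ereal) \<Rightarrow> bool" where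
  "on_second_block P h \<longleftrightarrow> (\<forall>(U, V) \<in> edom h. P (\<lambda>V'. h (U, V')))"

text \<open>
  Blockwise \<open>C\<^sup>1\<close>: the partial derivative in one block exists and is continuous as a function of
  both blocks jointly. Having this for both blocks amounts to being \<open>C\<^sup>1\<close>
  on the open set \<open>interior (edom h)\<close>.
\<close>

definition C1_first_block ::
    "('a::real_normed_vector \<times> 'b::real_normed_vector \<Rightarrow> ereal) \<Rightarrow> bool" where
  "C1_first_block h \<longleftrightarrow> (\<exists>D :: 'a \<times> 'b \<Rightarrow> 'a \<Rightarrow>\<^sub>L real.
     continuous_on (interior (edom h)) D \<and>
     (\<forall>(U, V) \<in> interior (edom h).
        ((\<lambda>U'. real_of_ereal (h (U', V))) has_derivative blinfun_apply (D (U, V))) (at U)))"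

definition C1_second_block ::
    "('a::real_normed_vector \<times> 'b::real_normed_vector \<Rightarrow> ereal) \<Rightarrow> bool" where
  "C1_second_block h \<longleftrightarrow> (\<exists>D :: 'a \<times> 'b \<Rightarrow> 'b \<Rightarrow>\<^sub>L real.
     continuous_on (interior (edom h)) D \<and>
     (\<forall>(U, V) \<in> interior (edom h).
        ((\<lambda>V'. real_of_ereal (h (U, V'))) has_derivative blinfun_apply (D (U, V))) (at V)))"

text \<open>
  An \<open>i\<close>-th block kernel is usually required to be jointly \<open>C\<^sup>1\<close> on \<open>interior (edom h)\<close>. Here only the
  \<open>i\<close>-th partial derivative is constrained: a kernel such as
  \<open>(U, V) \<mapsto> (c * norm V + \<epsilon>) * (norm U)\<^sup>2\<close> with \<open>c > 0\<close> is not differentiable in \<open>V\<close> at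
  \<open>V = 0\<close>, \<open>U \<noteq> 0\<close>, but is \<open>C\<^sup>1\<close> in the block \<open>U\<close> it is a kernel for.
\<close>

definition first_block_kernel ::
    "('a::real_normed_vector \<times> 'b::real_normed_vector \<Rightarrow> ereal) \<Rightarrow> bool" where
  "first_block_kernel h \<longleftrightarrow>
     proper_fun h \<and> lsc_fun h \<and> interior (edom h) \<noteq> {} \<and> C1_first_block h \<and>
     on_first_block (econvex_on UNIV) h \<and> on_first_block one_coercive h"

definition second_block_kernel ::
    "('a::real_normed_vector \<times> 'b::real_normed_vector \<Rightarrow> ereal) \<Rightarrow> bool" where
  "second_block_kernel h \<longleftrightarrow>
     proper_fun h \<and> lsc_fun h \<and> interior (edom h) \<noteq> {} \<and> C1_second_block h \<and>
     on_second_block (econvex_on UNIV) h \<and> on_second_block one_coercive h"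

definition relatively_smooth ::
    "real \<Rightarrow> real \<Rightarrow> ('a::real_normed_vector \<times> 'b::real_normed_vector \<Rightarrow> ereal) \<Rightarrow>
     ('a \<times> 'b \<Rightarrow> ereal) \<Rightarrow> ('a \<times> 'b \<Rightarrow> ereal) \<Rightarrow> bool" where
  "relatively_smooth L1 L2 h1 h2 f \<longleftrightarrow>
     first_block_kernel h1 \<and> second_block_kernel h2 \<and>
     proper_fun f \<and> lsc_fun f \<and> 0 < L1 \<and> 0 < L2 \<and>
     (\<forall>V. econvex_on {U. (U, V) \<in> interior (edom h1)}
            (\<lambda>U. ereal L1 * h1 (U, V) - f (U, V))) \<and>
     (\<forall>U. econvex_on {V. (U, V) \<in> interior (edom h2)}
            (\<lambda>V. ereal L2 * h2 (U, V) - f (U, V)))"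

end

theory Submission
  imports Defs
begin

section \<open>Real-valued functions as extended-real-valued functions\<close>

text \<open>All functions involved are finite, so the domains are the whole space and every claim
  reduces to real-valued functions.

  First block: for fixed V put T A B = A V B^T, bilinear with norm (T A B) <= norm V * norm A * norm
  B. Along a line p with direction d, the second derivative of half the squared residual is at most
  (6 * (norm V)^2 * (norm p)^2 + 2 * norm X * norm V) * (norm d)^2, while that of alpha * norm^4 +
  beta * norm^2 is at least (4 * alpha * (norm p)^2 + 2 * beta) * (norm d)^2. Comparing the
  coefficients of L1 * h1 gives L1 * a1 >= 6 and L1 * b1 >= 2. This is
  \<open>convex_on_quartic_minus_residual\<close>, fed by submultiplicativity of the Frobenius norm,
  \<open>norm_matrix_mult_le\<close>.

  Second block: f is quadratic in V, and the norm of U V U^T is at most (norm U)^2 * norm V, so L2 *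
  a2 >= 1 lets the quadratic kernel dominate (\<open>convex_on_quadratic_minus_residual\<close>).

  Strong convexity and 1-coercivity come from the quadratic terms, whose coefficients the positive
  epsilons keep away from 0. The term norm X * norm V makes h1 fail to be differentiable in V at V =
  0 when X and U are nonzero; hence joint C1 for h1 is asserted off V = 0 (or for X = 0), while the
  block derivative in U is continuous everywhere.\<close>

lemma edom_ereal [simp]: "edom (\<lambda>x. ereal (g x)) = UNIV"
  by (auto simp: edom_def)

lemma proper_fun_ereal: "proper_fun (\<lambda>x. ereal (g x))"
  by (simp add: proper_fun_def)

text \<open>In a \<open>perfect_space\<close> the punctured filter \<open>at x\<close> is
  nontrivial, so the \<open>Liminf\<close> is the limit supplied by continuity.\<close>

lemma lsc_fun_ereal:
  fixes g :: "'a::perfect_space \<Rightarrow> real"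
  assumes "continuous_on UNIV g"
  shows "lsc_fun (\<lambda>x. ereal (g x))"
  unfolding lsc_fun_def
proof
  fix x
  have "((\<lambda>y. ereal (g y)) \<longlongrightarrow> ereal (g x)) (at x)"
    using assms by (simp add: continuous_on_def)
  then have "Liminf (at x) (\<lambda>y. ereal (g y)) = ereal (g x)"
    by (intro lim_imp_Liminf) auto
  then show "ereal (g x) \<le> Liminf (at x) (\<lambda>y. ereal (g y))"
    by simp
qed

lemma econvex_on_ereal:
  assumes "convex_on S g"
  shows "econvex_on S (\<lambda>x. ereal (g x))"
  using assms by (auto simp: econvex_on_def convex_on_def)

lemma strongly_econvex_on_ereal:
  assumes "convex S" and "0 < \<mu>"
    and "\<And>x y u v. x \<in> S \<Longrightarrow> y \<in> S \<Longrightarrow> 0 \<le> u \<Longrightarrow> 0 \<le> v \<Longrightarrow> u + v = 1 \<Longrightarrow>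
      g (u *\<^sub>R x + v *\<^sub>R y) + \<mu> / 2 * u * v * (norm (x - y))\<^sup>2 \<le> u * g x + v * g y"
  shows "strongly_econvex_on S (\<lambda>x. ereal (g x))"
  unfolding strongly_econvex_on_def using assms by auto

lemma strongly_econvex_on_imp_econvex_on:
  assumes "strongly_econvex_on S (\<lambda>x. ereal (g x))"
  shows "econvex_on S (\<lambda>x. ereal (g x))"
  unfolding econvex_on_def
proof (intro conjI ballI allI impI)
  obtain \<mu> where "convex S" and "0 < \<mu>"
    and \<mu>: "\<forall>x\<in>S. \<forall>y\<in>S. \<forall>u\<ge>0. \<forall>v\<ge>0. u + v = 1 \<longrightarrow>
        ereal (g (u *\<^sub>R x + v *\<^sub>R y)) + ereal (\<mu> / 2 * u * v * (norm (x - y))\<^sup>2)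
          \<le> ereal u * ereal (g x) + ereal v * ereal (g y)"
    using assms unfolding strongly_econvex_on_def by blast
  show "convex S" by fact
  fix x y u v assume h: "x \<in> S" "y \<in> S" "0 \<le> u" "0 \<le> v" "u + v = (1::real)"
  have "0 \<le> \<mu> / 2 * u * v * (norm (x - y))\<^sup>2"
    using h \<open>0 < \<mu>\<close> by simp
  moreover have "g (u *\<^sub>R x + v *\<^sub>R y) + \<mu> / 2 * u * v * (norm (x - y))\<^sup>2 \<le> u * g x + v * g y"
    using \<mu> h by fastforce
  ultimately show "ereal (g (u *\<^sub>R x + v *\<^sub>R y)) \<le> ereal u * ereal (g x) + ereal v * ereal (g y)"
    by simp
qed

lemma one_coercive_ereal:
  fixes g :: "'a::real_normed_vector \<Rightarrow> real"
  assumes "0 < c" and "\<And>z. c * (norm z)\<^sup>2 \<le> g z"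
  shows "one_coercive (\<lambda>z. ereal (g z))"
proof -
  have "filterlim (\<lambda>z::'a. c * norm z) at_top at_infinity"
    using \<open>0 < c\<close> by (intro filterlim_tendsto_pos_mult_at_top[OF tendsto_const]) (auto simp: filterlim_norm_at_top)
  moreover have "eventually (\<lambda>z. c * norm z \<le> g z / norm z) at_infinity"
    unfolding eventually_at_infinity
  proof (intro exI[of _ 1] allI impI)
    fix z :: 'a assume "1 \<le> norm z"
    then have "0 < norm z" by linarith
    moreover have "c * norm z * norm z \<le> g z"
      using assms(2)[of z] by (simp add: power2_eq_square mult.assoc)
    ultimately show "c * norm z \<le> g z / norm z"
      by (simp add: pos_le_divide_eq)
  qed
  ultimately have "filterlim (\<lambda>z. g z / norm z) at_top at_infinity"
    by (rule filterlim_at_top_mono)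
  then have "((\<lambda>z. ereal (g z / norm z)) \<longlongrightarrow> \<infinity>) at_infinity"
    by (simp add: tendsto_PInfty_eq_at_top)
  \<comment> \<open>At z = 0 the real quotient is 0 by convention and the \<open>ereal\<close>
    quotient need not be, so the two are identified only far out.\<close>
  moreover have "eventually (\<lambda>z. ereal (g z / norm z) = ereal (g z) / ereal (norm z)) at_infinity"
    unfolding eventually_at_infinity by (intro exI[of _ 1]) auto
  ultimately show ?thesis
    unfolding one_coercive_def by (simp cong: tendsto_cong)
qed

text \<open>The map sending a vector to its inner-product functional is bounded linear, so a
  continuous gradient yields a derivative continuous in operator norm.\<close>

lemma C1_on_gradient:
  fixes g :: "'a::real_inner \<Rightarrow> real"
  assumes "continuous_on S G"
    and "\<And>x. x \<in> S \<Longrightarrow> (g has_derivative (\<lambda>d. G x \<bullet> d)) (at x)"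
  shows "C1_on S (\<lambda>x. ereal (g x))"
  unfolding C1_on_def
  using assms by (intro exI[of _ "\<lambda>x. blinfun_inner_right (G x)"])
    (auto intro!: bounded_linear.continuous_on[OF bounded_linear_blinfun_inner_right])

lemma C1_first_block_gradient:
  fixes g :: "'a::real_inner \<times> 'b::real_normed_vector \<Rightarrow> real"
  assumes "continuous_on UNIV G"
    and "\<And>x y. ((\<lambda>x. g (x, y)) has_derivative (\<lambda>d. G (x, y) \<bullet> d)) (at x)"
  shows "C1_first_block (\<lambda>p. ereal (g p))"
  unfolding C1_first_block_def
  using assms by (intro exI[of _ "\<lambda>p. blinfun_inner_right (G p)"])
    (auto intro!: bounded_linear.continuous_on[OF bounded_linear_blinfun_inner_right])

lemma C1_second_block_gradient:
  fixes g :: "'a::real_normed_vector \<times> 'b::real_inner \<Rightarrow> real"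
  assumes "continuous_on UNIV G"
    and "\<And>x y. ((\<lambda>y. g (x, y)) has_derivative (\<lambda>d. G (x, y) \<bullet> d)) (at y)"
  shows "C1_second_block (\<lambda>p. ereal (g p))"
  unfolding C1_second_block_def
  using assms by (intro exI[of _ "\<lambda>p. blinfun_inner_right (G p)"])
    (auto intro!: bounded_linear.continuous_on[OF bounded_linear_blinfun_inner_right])

section \<open>Convexity along lines\<close>

text \<open>Convexity only concerns segments, so the one-variable second derivative test applies on
  each line; \<open>g' x d t\<close> is the derivative at parameter t on the line through x with
  direction d.\<close>

lemma convex_on_UNIV_second_derivative:
  fixes g :: "'a::real_vector \<Rightarrow> real"
  assumes "\<And>x d t. ((\<lambda>s. g (x + s *\<^sub>R d)) has_real_derivative g' x d t) (at t)"
    and "\<And>x d t. (g' x d has_real_derivative g'' x d t) (at t)"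
    and "\<And>x d t. 0 \<le> g'' x d t"
  shows "convex_on UNIV g"
proof (rule convex_onI)
  fix t :: real and x y :: 'a
  assume "0 < t" "t < 1"
  have "convex_on UNIV (\<lambda>s. g (x + s *\<^sub>R (y - x)))"
    by (rule f''_ge0_imp_convex[where f' = "g' x (y - x)" and f'' = "g'' x (y - x)"])
      (use assms in auto)
  from convex_onD[OF this, of t 0 1] \<open>0 < t\<close> \<open>t < 1\<close>
  show "g ((1 - t) *\<^sub>R x + t *\<^sub>R y) \<le> (1 - t) * g x + t * g y"
    by (simp add: algebra_simps)
qed simp

text \<open>An exact Jensen gap rather than an inequality: it can be used with either sign, for the
  kernel and for the subtracted residual.\<close>

lemma norm_sq_convex_combination:
  fixes x y :: "'a::real_inner"
  assumes "u + v = 1"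
  shows "(norm (u *\<^sub>R x + v *\<^sub>R y))\<^sup>2 + u * v * (norm (x - y))\<^sup>2
    = u * (norm x)\<^sup>2 + v * (norm y)\<^sup>2"
proof -
  have v: "v = 1 - u" using assms by simp
  show ?thesis
    unfolding v power2_norm_eq_inner
    by (simp add: inner_simps inner_commute algebra_simps)
qed

text \<open>Squaring is convex, and increasing on nonnegative reals, so it preserves convexity of
  the squared norm.\<close>

lemma norm_pow4_convex_combination:
  fixes x y :: "'a::real_inner"
  assumes "0 \<le> u" "0 \<le> v" "u + v = 1"
  shows "(norm (u *\<^sub>R x + v *\<^sub>R y)) ^ 4 \<le> u * (norm x) ^ 4 + v * (norm y) ^ 4"
proof -
  have p4: "n ^ 4 = (n\<^sup>2)\<^sup>2" for n :: real
    by simp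
  have "(norm (u *\<^sub>R x + v *\<^sub>R y))\<^sup>2 \<le> u * (norm x)\<^sup>2 + v * (norm y)\<^sup>2"
    using norm_sq_convex_combination[OF assms(3), of x y] assms by (smt (verit) mult_nonneg_nonneg zero_le_power2)
  then have "((norm (u *\<^sub>R x + v *\<^sub>R y))\<^sup>2)\<^sup>2 \<le> (u * (norm x)\<^sup>2 + v * (norm y)\<^sup>2)\<^sup>2"
    by (intro power_mono) auto
  also have "\<dots> \<le> u * ((norm x)\<^sup>2)\<^sup>2 + v * ((norm y)\<^sup>2)\<^sup>2"
    \<comment> \<open>The same identity in the inner product space of reals gives convexity of
      squaring.\<close>
    using norm_sq_convex_combination[OF assms(3), of "(norm x)\<^sup>2" "(norm y)\<^sup>2"] assms
    by (smt (verit) mult_nonneg_nonneg zero_le_power2 real_norm_def power2_abs real_scaleR_def)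
  finally show ?thesis
    unfolding p4 .
qed

section \<open>Quadratic maps\<close>

text \<open>
  Along a line \<open>p = x + t d\<close> with \<open>R = X - T p p\<close>, the second derivative of \<open>(norm R)\<^sup>2 / 2\<close> is
  \<open>(norm (T d p + T p d))\<^sup>2 - 2 * (R \<bullet> T d d)\<close>, at most
  \<open>(6 * \<tau>\<^sup>2 * (norm p)\<^sup>2 + 2 * norm X * \<tau>) * (norm d)\<^sup>2\<close>.
\<close>

lemma convex_on_quartic_minus_residual:
  fixes T :: "'a::real_inner \<Rightarrow> 'a \<Rightarrow> 'b::real_inner"
  assumes "bounded_bilinear T"
    and bound: "\<And>x y. norm (T x y) \<le> \<tau> * norm x * norm y"
    and "0 \<le> \<tau>" and \<alpha>: "6 * \<tau>\<^sup>2 \<le> 4 * \<alpha>" and \<beta>: "2 * norm X * \<tau> \<le> 2 * \<beta>"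
  shows "convex_on UNIV (\<lambda>x. \<alpha> * (norm x) ^ 4 + \<beta> * (norm x)\<^sup>2 - 1/2 * (norm (X - T x x))\<^sup>2)"
    (is "convex_on UNIV ?g")
proof -
  interpret bounded_bilinear T by fact
  define p where "p x d t = x + t *\<^sub>R d" for x d :: 'a and t :: real
  define R where "R x d t = X - T (p x d t) (p x d t)" for x d t
  \<comment> \<open>The derivative of \<open>R\<close> along the line is \<open>- S\<close>, and
    that of \<open>S\<close> is \<open>2 *\<^sub>R T d d\<close>; the product rule then yields
    \<open>g'\<close> and \<open>g''\<close>.\<close>
  define S where "S x d t = T d (p x d t) + T (p x d t) d" for x d t
  define g' where "g' x d t = 4 * \<alpha> * (p x d t \<bullet> p x d t) * (p x d t \<bullet> d)
    + 2 * \<beta> * (p x d t \<bullet> d) + R x d t \<bullet> S x d t" for x d t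
  define g'' where "g'' x d t = 8 * \<alpha> * (p x d t \<bullet> d)\<^sup>2 + 4 * \<alpha> * (p x d t \<bullet> p x d t) * (d \<bullet> d)
    + 2 * \<beta> * (d \<bullet> d) + 2 * (R x d t \<bullet> T d d) - S x d t \<bullet> S x d t" for x d t
  have p': "(p x d has_derivative (\<lambda>s. s *\<^sub>R d)) (at t)" for x d t
    unfolding p_def by (auto intro!: derivative_eq_intros)
  have R': "(R x d has_derivative (\<lambda>s. - (s *\<^sub>R S x d t))) (at t)" for x d t
    unfolding R_def S_def
    by (rule derivative_eq_intros FDERIV p' refl)+ (simp add: scaleR_left scaleR_right algebra_simps)
  have S': "(S x d has_derivative (\<lambda>s. s *\<^sub>R (2 *\<^sub>R T d d))) (at t)" for x d t
    unfolding S_def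
    by (rule derivative_eq_intros FDERIV p' refl)+
      (simp add: scaleR_left scaleR_right zero_left zero_right fun_eq_iff scaleR_2 algebra_simps)
  \<comment> \<open>Inner products replace norms because they are differentiable also where the
    vector vanishes.\<close>
  have g_eq: "?g x = \<alpha> * (x \<bullet> x)\<^sup>2 + \<beta> * (x \<bullet> x) - 1/2 * ((X - T x x) \<bullet> (X - T x x))" for x
    by (simp add: power2_norm_eq_inner[symmetric])
  show ?thesis
  proof (rule convex_on_UNIV_second_derivative[where g' = g' and g'' = g''])
    fix x d t
    have "((\<lambda>s. \<alpha> * (p x d s \<bullet> p x d s)\<^sup>2 + \<beta> * (p x d s \<bullet> p x d s) - 1/2 * (R x d s \<bullet> R x d s))
      has_real_derivative g' x d t) (at t)"
      unfolding has_field_derivative_def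
      by (rule derivative_eq_intros p' R' refl)+
        (simp add: g'_def fun_eq_iff inner_commute algebra_simps)
    then show "((\<lambda>s. ?g (x + s *\<^sub>R d)) has_real_derivative g' x d t) (at t)"
      unfolding g_eq p_def R_def .
    show "(g' x d has_real_derivative g'' x d t) (at t)"
      unfolding has_field_derivative_def g'_def
      by (rule derivative_eq_intros p' R' S' refl)+
        (simp add: g''_def fun_eq_iff inner_commute power2_eq_square algebra_simps)
    have S: "S x d t \<bullet> S x d t \<le> 4 * (\<tau>\<^sup>2 * ((norm (p x d t))\<^sup>2 * (norm d)\<^sup>2))"
    proof -
      have "norm (S x d t) \<le> 2 * \<tau> * norm (p x d t) * norm d"
        unfolding S_def using norm_triangle_le[OF add_mono[OF bound[of d "p x d t"] bound[of "p x d t" d]]]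
        by (simp add: mult_ac)
      then have "(norm (S x d t))\<^sup>2 \<le> (2 * \<tau> * norm (p x d t) * norm d)\<^sup>2"
        by (intro power_mono) auto
      then show ?thesis
        by (simp add: power2_norm_eq_inner[symmetric] power_mult_distrib mult.assoc)
    qed
    have C: "norm (T d d) \<le> \<tau> * (norm d)\<^sup>2"
      using bound[of d d] by (simp add: power2_eq_square mult.assoc)
    have "\<bar>R x d t \<bullet> T d d\<bar> \<le> norm (R x d t) * norm (T d d)"
      by (rule Cauchy_Schwarz_ineq2)
    also have "\<dots> \<le> (norm X + \<tau> * (norm (p x d t))\<^sup>2) * (\<tau> * (norm d)\<^sup>2)"
    proof (rule mult_mono)
      show "norm (R x d t) \<le> norm X + \<tau> * (norm (p x d t))\<^sup>2"
        unfolding R_def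
        using norm_triangle_le_diff[OF add_left_mono[OF bound[of "p x d t" "p x d t"], of "norm X"]]
        by (simp add: power2_eq_square mult.assoc)
    qed (use C \<open>0 \<le> \<tau>\<close> in auto)
    finally have "\<bar>R x d t \<bullet> T d d\<bar> \<le> (norm X + \<tau> * (norm (p x d t))\<^sup>2) * (\<tau> * (norm d)\<^sup>2)" .
    then have R: "- (norm X * \<tau> * (norm d)\<^sup>2 + \<tau>\<^sup>2 * ((norm (p x d t))\<^sup>2 * (norm d)\<^sup>2)) \<le> R x d t \<bullet> T d d"
      by (simp add: algebra_simps power2_eq_square)
    \<comment> \<open>The 6 is 4 from \<open>S\<close> paired with itself plus 2 from twice the
      pairing of \<open>R\<close> with \<open>T d d\<close>. The quartic offers 4 \<alpha> once its
      nonnegative square term is discarded.\<close>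
    have "6 * \<tau>\<^sup>2 * ((norm (p x d t))\<^sup>2 * (norm d)\<^sup>2) \<le> 4 * \<alpha> * ((norm (p x d t))\<^sup>2 * (norm d)\<^sup>2)"
      using \<alpha> by (rule mult_right_mono) simp
    moreover have "2 * norm X * \<tau> * (norm d)\<^sup>2 \<le> 2 * \<beta> * (norm d)\<^sup>2"
      using \<beta> by (rule mult_right_mono) simp
    moreover have "0 \<le> 8 * \<alpha> * (p x d t \<bullet> d)\<^sup>2"
    proof -
      have "0 \<le> \<alpha>" using \<alpha> zero_le_power2[of \<tau>] by linarith
      then show ?thesis by simp
    qed
    ultimately show "0 \<le> g'' x d t"
      unfolding g''_def using R S by (simp add: power2_norm_eq_inner[symmetric] mult_ac)
  qed
qed

text \<open>By the exact gap identity, the convexity gap of the difference is (1 - t) * t times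
  \<gamma> * (norm (x - y))^2 - (norm (T (x - y)))^2 / 2, nonnegative by
  \<open>bound\<close>.\<close>

lemma convex_on_quadratic_minus_residual:
  fixes T :: "'a::real_inner \<Rightarrow> 'b::real_inner"
  assumes "linear T" and bound: "\<And>x. (norm (T x))\<^sup>2 \<le> 2 * \<gamma> * (norm x)\<^sup>2"
  shows "convex_on UNIV (\<lambda>x. \<gamma> * (norm x)\<^sup>2 - 1/2 * (norm (X - T x))\<^sup>2)"
proof (rule convex_onI)
  fix t :: real and x y :: 'a
  assume t: "0 < t" "t < 1"
  interpret linear T by fact
  define z where "z = (1 - t) *\<^sub>R x + t *\<^sub>R y"
  have "(norm z)\<^sup>2 + (1 - t) * t * (norm (x - y))\<^sup>2 = (1 - t) * (norm x)\<^sup>2 + t * (norm y)\<^sup>2"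
    unfolding z_def by (rule norm_sq_convex_combination) simp
  then have nz: "(norm z)\<^sup>2 = (1 - t) * (norm x)\<^sup>2 + t * (norm y)\<^sup>2 - (1 - t) * t * (norm (x - y))\<^sup>2"
    by simp
  have "X - T z = (1 - t) *\<^sub>R (X - T x) + t *\<^sub>R (X - T y)"
    unfolding z_def add scale by (simp add: algebra_simps)
  then have "(norm (X - T z))\<^sup>2 + (1 - t) * t * (norm ((X - T x) - (X - T y)))\<^sup>2
      = (1 - t) * (norm (X - T x))\<^sup>2 + t * (norm (X - T y))\<^sup>2"
    using norm_sq_convex_combination[of "1 - t" t "X - T x" "X - T y"] by simp
  moreover have "norm ((X - T x) - (X - T y)) = norm (T (x - y))"
    by (simp add: diff norm_minus_commute)
  ultimately have nT: "(norm (X - T z))\<^sup>2 = (1 - t) * (norm (X - T x))\<^sup>2 + t * (norm (X - T y))\<^sup>2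
      - (1 - t) * t * (norm (T (x - y)))\<^sup>2"
    by simp
  have "(1 - t) * t * (norm (T (x - y)))\<^sup>2 \<le> (1 - t) * t * (2 * \<gamma> * (norm (x - y))\<^sup>2)"
    using t bound by (intro mult_left_mono) auto
  then show "\<gamma> * (norm ((1 - t) *\<^sub>R x + t *\<^sub>R y))\<^sup>2 - 1/2 * (norm (X - T ((1 - t) *\<^sub>R x + t *\<^sub>R y)))\<^sup>2
      \<le> (1 - t) * (\<gamma> * (norm x)\<^sup>2 - 1/2 * (norm (X - T x))\<^sup>2)
        + t * (\<gamma> * (norm y)\<^sup>2 - 1/2 * (norm (X - T y))\<^sup>2)"
    unfolding z_def[symmetric] nz nT by (simp add: algebra_simps diff_divide_distrib add_divide_distrib)
qed simp

section \<open>The Frobenius norm of a product\<close>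

lemma norm_transpose:
  fixes A :: "real^'n^'m"
  shows "norm (transpose A) = norm A"
  unfolding norm_matrix_eq_Frobenius transpose_def by (simp add: sum.swap[of "\<lambda>i j. (A $ j $ i)\<^sup>2"])

text \<open>Each entry of the product is a row of A paired with a column of B; Cauchy-Schwarz bounds
  its square, and the double sum of the bounds factors.\<close>

lemma norm_matrix_mult_le:
  fixes A :: "real^'n^'m" and B :: "real^'k^'n"
  shows "norm (A ** B) \<le> norm A * norm B"
proof -
  have sq: "(norm C)\<^sup>2 = (\<Sum>i\<in>UNIV. (norm (C $ i))\<^sup>2)" for C :: "real^'x^'y"
    by (simp add: norm_vec_def L2_set_def sum_nonneg)
  have "(norm (A ** B))\<^sup>2 = (\<Sum>i\<in>UNIV. \<Sum>j\<in>UNIV. (A $ i \<bullet> transpose B $ j)\<^sup>2)"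
    unfolding norm_matrix_eq_Frobenius
    by (simp add: sum_nonneg matrix_matrix_mult_def transpose_def inner_vec_def)
  also have "\<dots> \<le> (\<Sum>i\<in>UNIV. \<Sum>j\<in>UNIV. (norm (A $ i))\<^sup>2 * (norm (transpose B $ j))\<^sup>2)"
    by (intro sum_mono) (metis Cauchy_Schwarz_ineq power2_norm_eq_inner)
  also have "\<dots> = (norm A)\<^sup>2 * (norm (transpose B))\<^sup>2"
    unfolding sq by (rule sum_product[symmetric])
  finally show ?thesis
    unfolding norm_transpose by (simp flip: power_mult_distrib)
qed

lemma bounded_bilinear_matrix_mult:
  "bounded_bilinear ((**) :: real^'n^'m \<Rightarrow> real^'k^'n \<Rightarrow> real^'k^'m)"
proof
  fix A A' :: "real^'n^'m" and B B' :: "real^'k^'n" and c :: real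
  show "(A + A') ** B = A ** B + A' ** B"
    by (simp add: matrix_matrix_mult_def vec_eq_iff sum.distrib distrib_right)
  show "A ** (B + B') = A ** B + A ** B'"
    by (rule matrix_add_ldistrib)
  show "(c *\<^sub>R A) ** B = c *\<^sub>R (A ** B)" "A ** (c *\<^sub>R B) = c *\<^sub>R (A ** B)"
    by (simp_all add: matrix_matrix_mult_def vec_eq_iff sum_distrib_left mult_ac)
next
  show "\<exists>K. \<forall>(A :: real^'n^'m) (B :: real^'k^'n). norm (A ** B) \<le> norm A * norm B * K"
    by (intro exI[of _ 1]) (simp add: norm_matrix_mult_le)
qed

lemma bounded_linear_transpose: "bounded_linear (transpose :: real^'n^'m \<Rightarrow> real^'m^'n)"
proof (rule bounded_linear_intro[where K = 1])
  fix A :: "real^'n^'m"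
  show "norm (transpose A) \<le> norm A * 1"
    by (simp add: norm_transpose)
qed (simp_all add: transpose_def vec_eq_iff)

text \<open>\<open>norm V\<close> stands first so as to match \<tau> in
  \<open>convex_on_quartic_minus_residual\<close>.\<close>

lemma norm_congruence_le:
  fixes A B :: "real^'r^'m" and V :: "real^'r^'r"
  shows "norm (A ** V ** transpose B) \<le> norm V * norm A * norm B"
proof -
  have "norm (A ** V ** transpose B) \<le> norm (A ** V) * norm (transpose B)"
    by (rule norm_matrix_mult_le)
  also have "\<dots> \<le> (norm A * norm V) * norm B"
    unfolding norm_transpose by (intro mult_right_mono norm_matrix_mult_le) simp
  finally show ?thesis
    by (simp add: mult_ac)
qed

lemma bounded_bilinear_congruence:
  fixes V :: "real^'r^'r"
  shows "bounded_bilinear (\<lambda>A B :: real^'r^'m. A ** V ** transpose B)"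
  by (rule bounded_bilinear.comp[OF bounded_bilinear_matrix_mult
      bounded_bilinear.bounded_linear_left[OF bounded_bilinear_matrix_mult] bounded_linear_transpose])

lemma linear_congruence:
  fixes U :: "real^'r^'m"
  shows "linear (\<lambda>V. U ** V ** transpose U)"
  by (intro bounded_linear.linear bounded_linear_compose[OF
      bounded_bilinear.bounded_linear_left[OF bounded_bilinear_matrix_mult]
      bounded_bilinear.bounded_linear_right[OF bounded_bilinear_matrix_mult]])

section \<open>The kernels and the residual\<close>

text \<open>The quartic part is convex and the quadratic part has gap exactly \<beta> * u * v *
  (norm (x - y))^2, whence the modulus 2 \<beta>.\<close>

lemma strongly_econvex_on_quartic:
  assumes "0 \<le> \<alpha>" and "0 < \<beta>"
  shows "strongly_econvex_on UNIV (\<lambda>x::'a::real_inner. ereal (\<alpha> * (norm x) ^ 4 + \<beta> * (norm x)\<^sup>2))"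
proof (rule strongly_econvex_on_ereal[where \<mu> = "2 * \<beta>"])
  fix x y :: 'a and u v :: real
  assume uv: "0 \<le> u" "0 \<le> v" "u + v = 1"
  have "\<alpha> * (norm (u *\<^sub>R x + v *\<^sub>R y)) ^ 4 \<le> \<alpha> * (u * (norm x) ^ 4 + v * (norm y) ^ 4)"
    using norm_pow4_convex_combination[OF uv] \<open>0 \<le> \<alpha>\<close> by (rule mult_left_mono)
  moreover have "\<beta> * ((norm (u *\<^sub>R x + v *\<^sub>R y))\<^sup>2 + u * v * (norm (x - y))\<^sup>2)
      = \<beta> * (u * (norm x)\<^sup>2 + v * (norm y)\<^sup>2)"
    unfolding norm_sq_convex_combination[OF uv(3)] ..
  ultimately show "\<alpha> * (norm (u *\<^sub>R x + v *\<^sub>R y)) ^ 4 + \<beta> * (norm (u *\<^sub>R x + v *\<^sub>R y))\<^sup>2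
      + 2 * \<beta> / 2 * u * v * (norm (x - y))\<^sup>2
      \<le> u * (\<alpha> * (norm x) ^ 4 + \<beta> * (norm x)\<^sup>2) + v * (\<alpha> * (norm y) ^ 4 + \<beta> * (norm y)\<^sup>2)"
    by (simp add: algebra_simps)
qed (use assms in auto)

lemma one_coercive_quartic:
  assumes "0 \<le> \<alpha>" and "0 < \<beta>"
  shows "one_coercive (\<lambda>x::'a::real_normed_vector. ereal (\<alpha> * (norm x) ^ 4 + \<beta> * (norm x)\<^sup>2))"
  using assms by (intro one_coercive_ereal[where c = \<beta>]) auto

lemma has_derivative_norm_sq:
  fixes x :: "'a::real_inner"
  shows "((\<lambda>x. (norm x)\<^sup>2) has_derivative (\<lambda>d. 2 * (x \<bullet> d))) (at x)"
  unfolding power2_norm_eq_inner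
  by (auto intro!: derivative_eq_intros simp: inner_commute)

lemma has_derivative_norm_pow4:
  fixes x :: "'a::real_inner"
  shows "((\<lambda>x. (norm x) ^ 4) has_derivative (\<lambda>d. 4 * (norm x)\<^sup>2 * (x \<bullet> d))) (at x)"
proof -
  have p4: "(norm y) ^ 4 = ((norm y)\<^sup>2)\<^sup>2" for y :: 'a
    by simp
  show ?thesis
    unfolding p4
    by (rule derivative_eq_intros has_derivative_norm_sq refl)+ (simp add: fun_eq_iff)
qed

theorem proposition2p4:
  fixes X :: "real^'m^'m"
    and a1 b1 a2 \<epsilon>1 \<epsilon>2 L1 L2 :: real
    and h1 h2 f :: "(real^'r^'m) \<times> (real^'r^'r) \<Rightarrow> ereal"
  assumes "transpose X = X"
    and "0 < a1" and "0 < b1" and "0 < a2" and "0 < \<epsilon>1" and "0 < \<epsilon>2"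
    and "\<And>U V. h1 (U, V) = ereal (a1 / 4 * (norm V)\<^sup>2 * (norm U) ^ 4
                 + b1 / 2 * (norm X * norm V + \<epsilon>1) * (norm U)\<^sup>2)"
    and "\<And>U V. h2 (U, V) = ereal (a2 / 2 * ((norm U) ^ 4 + \<epsilon>2) * (norm V)\<^sup>2)"
    and "\<And>U V. f (U, V) = ereal (1 / 2 * (norm (X - U ** V ** transpose U))\<^sup>2)"
    and "L1 \<ge> max (6 / a1) (2 / b1)" and "L2 \<ge> 1 / a2"
  shows "first_block_kernel h1 \<and> on_first_block (strongly_econvex_on UNIV) h1
       \<and> C1_on {p \<in> interior (edom h1). X = 0 \<or> snd p \<noteq> 0} h1
       \<and> second_block_kernel h2 \<and> on_second_block (strongly_econvex_on UNIV) h2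
       \<and> C1_on (interior (edom h2)) h2
       \<and> relatively_smooth L1 L2 h1 h2 f"
proof -
  have L1: "6 \<le> L1 * a1" "2 \<le> L1 * b1" and "1 \<le> L2 * a2" and pos: "0 < L1" "0 < L2"
  proof -
    have "6 / a1 \<le> L1" "2 / b1 \<le> L1" "1 / a2 \<le> L2"
      using assms by auto
    then show "6 \<le> L1 * a1" "2 \<le> L1 * b1" "1 \<le> L2 * a2"
      using assms(2-4) by (simp_all add: pos_divide_le_eq)
    show "0 < L1" "0 < L2"
      using \<open>6 / a1 \<le> L1\<close> \<open>1 / a2 \<le> L2\<close> assms(2-4)
      by (meson divide_pos_pos less_le_trans zero_less_numeral zero_less_one)+
  qed
  have h1: "h1 = (\<lambda>p. ereal (a1 / 4 * (norm (snd p))\<^sup>2 * (norm (fst p)) ^ 4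
      + b1 / 2 * (norm X * norm (snd p) + \<epsilon>1) * (norm (fst p))\<^sup>2))"
    using assms(7) by auto
  have h2: "h2 = (\<lambda>p. ereal (a2 / 2 * ((norm (fst p)) ^ 4 + \<epsilon>2) * (norm (snd p))\<^sup>2))"
    using assms(8) by auto
  have f: "f = (\<lambda>p. ereal (1 / 2 * (norm (X - fst p ** snd p ** transpose (fst p)))\<^sup>2))"
    using assms(9) by auto
  have dom: "edom h1 = UNIV" "edom h2 = UNIV"
    unfolding h1 h2 by simp_all
  have \<alpha>: "0 \<le> a1 / 4 * (norm V)\<^sup>2" and \<beta>: "0 < b1 / 2 * (norm X * norm V + \<epsilon>1)"
    and \<gamma>: "0 < a2 / 2 * ((norm U) ^ 4 + \<epsilon>2)" for U :: "real^'r^'m" and V :: "real^'r^'r"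
    using assms(2-6) by (simp_all add: add_nonneg_pos)

  \<comment> \<open>Strong convexity and coercivity of each kernel in its own block\<close>
  have strong1: "on_first_block (strongly_econvex_on UNIV) h1"
    unfolding on_first_block_def
    using strongly_econvex_on_quartic[OF \<alpha> \<beta>] by (auto simp: h1)
  have convex1: "on_first_block (econvex_on UNIV) h1"
    using strong1 unfolding on_first_block_def h1
    by (auto intro!: strongly_econvex_on_imp_econvex_on)
  have coercive1: "on_first_block one_coercive h1"
    unfolding on_first_block_def
    using one_coercive_quartic[OF \<alpha> \<beta>] by (auto simp: h1)
  \<comment> \<open>\<open>order_refl\<close> selects \<alpha> = 0: in V the kernel
    \<open>h2\<close> is purely quadratic.\<close>
  have strong2: "on_second_block (strongly_econvex_on UNIV) h2"
    unfolding on_second_block_def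
    using strongly_econvex_on_quartic[OF order_refl \<gamma>] by (auto simp: h2)
  have convex2: "on_second_block (econvex_on UNIV) h2"
    using strong2 unfolding on_second_block_def h2
    by (auto intro!: strongly_econvex_on_imp_econvex_on)
  have coercive2: "on_second_block one_coercive h2"
    unfolding on_second_block_def
    using one_coercive_quartic[OF order_refl \<gamma>] by (auto simp: h2)

  \<comment> \<open>Continuity of the block derivatives\<close>
  have block1: "C1_first_block h1"
    unfolding h1
  \<comment> \<open>The gradient in U contains \<open>norm V\<close> only as a continuous
    coefficient, so V = 0 causes no trouble.\<close>
  proof (rule C1_first_block_gradient[where G = "\<lambda>p. (a1 * (norm (snd p))\<^sup>2 * (norm (fst p))\<^sup>2
      + b1 * (norm X * norm (snd p) + \<epsilon>1)) *\<^sub>R fst p"])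
    fix U :: "real^'r^'m" and V :: "real^'r^'r"
    show "((\<lambda>U. a1 / 4 * (norm (snd (U, V)))\<^sup>2 * (norm (fst (U, V))) ^ 4
        + b1 / 2 * (norm X * norm (snd (U, V)) + \<epsilon>1) * (norm (fst (U, V)))\<^sup>2) has_derivative
      (\<lambda>d. ((a1 * (norm (snd (U, V)))\<^sup>2 * (norm (fst (U, V)))\<^sup>2
        + b1 * (norm X * norm (snd (U, V)) + \<epsilon>1)) *\<^sub>R fst (U, V)) \<bullet> d)) (at U)"
      unfolding fst_conv snd_conv
      by (rule derivative_eq_intros has_derivative_norm_sq has_derivative_norm_pow4 refl)+
        (simp add: fun_eq_iff algebra_simps)
  qed (intro continuous_intros)
  have block2: "C1_second_block h2"
    unfolding h2
  proof (rule C1_second_block_gradient[where G = "\<lambda>p. (a2 * ((norm (fst p)) ^ 4 + \<epsilon>2)) *\<^sub>R snd p"])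
    fix U :: "real^'r^'m" and V :: "real^'r^'r"
    show "((\<lambda>V. a2 / 2 * ((norm (fst (U, V))) ^ 4 + \<epsilon>2) * (norm (snd (U, V)))\<^sup>2) has_derivative
      (\<lambda>d. ((a2 * ((norm (fst (U, V))) ^ 4 + \<epsilon>2)) *\<^sub>R snd (U, V)) \<bullet> d)) (at V)"
      unfolding fst_conv snd_conv
      by (rule derivative_eq_intros has_derivative_norm_sq refl)+
        (simp add: fun_eq_iff algebra_simps)
  qed (intro continuous_intros)

  \<comment> \<open>Joint differentiability of the kernels\<close>
  have fst_sq: "((\<lambda>p. (norm (fst p))\<^sup>2) has_derivative (\<lambda>d. 2 * (fst p \<bullet> fst d))) (at p)"
    and fst_pow4: "((\<lambda>p. (norm (fst p)) ^ 4) has_derivative (\<lambda>d. 4 * (norm (fst p))\<^sup>2 * (fst p \<bullet> fst d))) (at p)"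
    and snd_sq: "((\<lambda>p. (norm (snd p))\<^sup>2) has_derivative (\<lambda>d. 2 * (snd p \<bullet> snd d))) (at p)"
    for p :: "(real^'r^'m) \<times> (real^'r^'r)"
    by (rule has_derivative_compose[OF has_derivative_fst[OF has_derivative_ident] has_derivative_norm_sq]
        has_derivative_compose[OF has_derivative_fst[OF has_derivative_ident] has_derivative_norm_pow4]
        has_derivative_compose[OF has_derivative_snd[OF has_derivative_ident] has_derivative_norm_sq])+
  have C1_1: "C1_on {p \<in> interior (edom h1). X = 0 \<or> snd p \<noteq> 0} h1"
  proof -
    define S where "S = {p :: (real^'r^'m) \<times> (real^'r^'r). X = 0 \<or> snd p \<noteq> 0}"
    \<comment> \<open>The gradient of norm X * norm V in V: identically 0 if X = 0, and otherwise
      continuous where V is nonzero.\<close>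
    define w where "w V = norm X *\<^sub>R sgn V" for V :: "real^'r^'r"
    have w_cont: "continuous_on S (\<lambda>p. w (snd p))"
      unfolding w_def S_def by (cases "X = 0") (auto intro!: continuous_intros)
    have w: "((\<lambda>p. norm X * norm (snd p)) has_derivative (\<lambda>d. w (snd p) \<bullet> snd d)) (at p)"
      if "p \<in> S" for p
    proof (cases "X = 0")
      case False
      then have "((\<lambda>p. norm (snd p)) has_derivative (\<lambda>d. snd d \<bullet> sgn (snd p))) (at p)"
        using that unfolding S_def
        by (intro has_derivative_compose[OF has_derivative_snd[OF has_derivative_ident] has_derivative_norm]) auto
      from has_derivative_mult_right[OF this, of "norm X"] show ?thesis
        by (simp add: w_def inner_commute)
    qed (simp add: w_def)
    define G where "G p = ((a1 * (norm (snd p))\<^sup>2 * (norm (fst p))\<^sup>2 + b1 * (norm X * norm (snd p) + \<epsilon>1)) *\<^sub>R fst p,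
      (a1 / 2 * (norm (fst p)) ^ 4) *\<^sub>R snd p + (b1 / 2 * (norm (fst p))\<^sup>2) *\<^sub>R w (snd p))"
      for p :: "(real^'r^'m) \<times> (real^'r^'r)"
    have "C1_on S h1"
      unfolding h1
    proof (rule C1_on_gradient)
      show "continuous_on S G"
        unfolding G_def by (intro continuous_intros w_cont)
      fix p assume "p \<in> S"
      show "((\<lambda>p. a1 / 4 * (norm (snd p))\<^sup>2 * (norm (fst p)) ^ 4
          + b1 / 2 * (norm X * norm (snd p) + \<epsilon>1) * (norm (fst p))\<^sup>2) has_derivative
        (\<lambda>d. G p \<bullet> d)) (at p)"
        unfolding G_def
        by (rule derivative_eq_intros fst_sq fst_pow4 snd_sq w[OF \<open>p \<in> S\<close>] refl)+
          (simp add: fun_eq_iff inner_prod_def inner_simps algebra_simps)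
    qed
    then show ?thesis
      unfolding dom S_def by simp
  qed
  have C1_2: "C1_on (interior (edom h2)) h2"
    unfolding dom interior_UNIV unfolding h2
  proof (rule C1_on_gradient[where G = "\<lambda>p. ((2 * a2 * (norm (fst p))\<^sup>2 * (norm (snd p))\<^sup>2) *\<^sub>R fst p,
      (a2 * ((norm (fst p)) ^ 4 + \<epsilon>2)) *\<^sub>R snd p)"])
    fix p :: "(real^'r^'m) \<times> (real^'r^'r)"
    show "((\<lambda>p. a2 / 2 * ((norm (fst p)) ^ 4 + \<epsilon>2) * (norm (snd p))\<^sup>2) has_derivative
      (\<lambda>d. ((2 * a2 * (norm (fst p))\<^sup>2 * (norm (snd p))\<^sup>2) *\<^sub>R fst p,
        (a2 * ((norm (fst p)) ^ 4 + \<epsilon>2)) *\<^sub>R snd p) \<bullet> d)) (at p)"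
      by (rule derivative_eq_intros fst_pow4 snd_sq refl)+
        (simp add: fun_eq_iff inner_prod_def algebra_simps)
  qed (intro continuous_intros)

  \<comment> \<open>The kernel properties and lower semicontinuity\<close>
  have kernel1: "first_block_kernel h1"
    unfolding first_block_kernel_def
  proof (intro conjI block1 convex1 coercive1)
    show "proper_fun h1" unfolding h1 by (rule proper_fun_ereal)
    show "lsc_fun h1" unfolding h1 by (intro lsc_fun_ereal continuous_intros)
  qed (simp add: dom)
  have kernel2: "second_block_kernel h2"
    unfolding second_block_kernel_def
  proof (intro conjI block2 convex2 coercive2)
    show "proper_fun h2" unfolding h2 by (rule proper_fun_ereal)
    show "lsc_fun h2" unfolding h2 by (intro lsc_fun_ereal continuous_intros)
  qed (simp add: dom)
  have "lsc_fun f"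
    unfolding f
    by (intro lsc_fun_ereal continuous_intros bounded_bilinear.continuous_on[OF bounded_bilinear_matrix_mult]
        bounded_linear.continuous_on[OF bounded_linear_transpose])

  \<comment> \<open>Relative smoothness in each block\<close>
  have smooth1: "econvex_on {U. (U, V) \<in> interior (edom h1)} (\<lambda>U. ereal L1 * h1 (U, V) - f (U, V))" for V
  proof -
    have "convex_on UNIV (\<lambda>U. L1 * (a1 / 4 * (norm V)\<^sup>2) * (norm U) ^ 4
        + L1 * (b1 / 2 * (norm X * norm V + \<epsilon>1)) * (norm U)\<^sup>2
        - 1/2 * (norm (X - U ** V ** transpose U))\<^sup>2)"
    proof (rule convex_on_quartic_minus_residual[OF bounded_bilinear_congruence norm_congruence_le])
      show "6 * (norm V)\<^sup>2 \<le> 4 * (L1 * (a1 / 4 * (norm V)\<^sup>2))"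
        using mult_right_mono[OF L1(1), of "(norm V)\<^sup>2"] by (simp add: mult_ac)
      \<comment> \<open>Here \<open>L1 * b1\<close> supplies the factor 2, and adding \<epsilon>1
        only enlarges the other factor.\<close>
      have "2 * (norm X * norm V) \<le> L1 * b1 * (norm X * norm V + \<epsilon>1)"
        using L1(2) assms(5) by (intro mult_mono) auto
      then show "2 * norm X * norm V \<le> 2 * (L1 * (b1 / 2 * (norm X * norm V + \<epsilon>1)))"
        by (simp add: algebra_simps)
    qed simp
    from econvex_on_ereal[OF this] show ?thesis
      unfolding dom by (simp add: h1 f algebra_simps)
  qed
  have smooth2: "econvex_on {V. (U, V) \<in> interior (edom h2)} (\<lambda>V. ereal L2 * h2 (U, V) - f (U, V))" for U
  proof -
    have "convex_on UNIV (\<lambda>V. L2 * (a2 / 2 * ((norm U) ^ 4 + \<epsilon>2)) * (norm V)\<^sup>2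
        - 1/2 * (norm (X - U ** V ** transpose U))\<^sup>2)"
    proof (rule convex_on_quadratic_minus_residual[OF linear_congruence])
      fix V :: "real^'r^'r"
      have "(norm (U ** V ** transpose U))\<^sup>2 \<le> (norm V * norm U * norm U)\<^sup>2"
        by (intro power_mono norm_congruence_le) simp
      also have "\<dots> = 1 * ((norm U) ^ 4) * (norm V)\<^sup>2"
        by (simp add: power2_eq_square power4_eq_xxxx)
      \<comment> \<open>The factor 1 grows to \<open>L2 * a2\<close> and (norm U)^4 grows by
        \<epsilon>2.\<close>
      also have "\<dots> \<le> L2 * a2 * ((norm U) ^ 4 + \<epsilon>2) * (norm V)\<^sup>2"
        using \<open>1 \<le> L2 * a2\<close> assms(6) by (intro mult_mono) auto
      finally show "(norm (U ** V ** transpose U))\<^sup>2 \<le> 2 * (L2 * (a2 / 2 * ((norm U) ^ 4 + \<epsilon>2))) * (norm V)\<^sup>2"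
        by (simp add: algebra_simps)
    qed
    from econvex_on_ereal[OF this] show ?thesis
      unfolding dom by (simp add: h2 f algebra_simps)
  qed
  have "relatively_smooth L1 L2 h1 h2 f"
    unfolding relatively_smooth_def
    using kernel1 kernel2 \<open>lsc_fun f\<close> pos smooth1 smooth2 by (auto simp: f proper_fun_ereal)
  then show ?thesis
    using kernel1 kernel2 strong1 strong2 C1_1 C1_2 by blast
qed

end
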